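(* Let $q$ be a prime power, $m$ a positive integer, and let $D\subseteq\mathbb{F}_{q^m}^*$ be an $\mathbb{F}_q^*$-invariant partial difference set with parameters $(q^m,k,\lambda,\mu)$. Let $\theta_1>0>\theta_2$ be the two restricted eigenvalues of $\mathrm{Cay}(\mathbb{F}_{q^m},D)$ and $\theta_0=\max\{|\theta_1|,|\theta_2|\}$. Suppose that (1) $k-\theta_2\neq q^m$; (2) $k>\theta_1$ and $k>-(q-1)\theta_2$; and at least one of the following holds: (3a) $k<q^m+q\theta_2-(q-1)\theta_1$; (3b) $k>\max\{q\theta_0+\theta_1,\ q\theta_0-(q-1)\theta_2\}$; (3c) $q^{m-1}+\theta_2-\theta_1>\theta_0$. Then the code $\mathcal C(M_D)$ is minimal.
   Context: $\mathrm{Tr}=\mathrm{Tr}_{\mathbb{F}_{q^m}/\mathbb{F}_q}$. A subset $D$ is $\mathbb{F}_q^*$-invariant if $\lambda d\in D$ for all $\lambda\in\mathbb{F}_q^*$, $d\in D$. A strongly regular graph $(v,k,\lambda,\mu)$ is a simple undirected graph, neither complete nor edgeless, which is $k$-regular on $v$ vertices, in which any two adjacent vertices have exactly $\lambda$ common neighbours and any two nonadjacent vertices have exactly $\mu$ common neighbours. For $D\subseteq\mathbb{F}_{q^m}^*$ with $-D=D$, the Cayley graph $\mathrm{Cay}(\mathbb{F}_{q^m},D)$ has vertex set $\mathbb{F}_{q^m}$, with $x\sim y$ iff $x-y\in D$; $D$ is a partial difference set with parameters $(v,k,\lambda,\mu)$ if this graph is strongly regular with these parameters (then $k=|D|$).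 An eigenvalue of the adjacency matrix is restricted if it has an eigenvector orthogonal to the all-one vector; a strongly regular graph has exactly two restricted eigenvalues $\theta_1>0>\theta_2$, and for a partial difference set $D$ one has $\sum_{d\in D}\Psi(ad)\in\{\theta_1,\theta_2\}$ for every $a\in\mathbb{F}_{q^m}^*$, where $\Psi(x)=\zeta_p^{\mathrm{Tr}_{\mathbb{F}_{q^m}/\mathbb{F}_p}(x)}$ is the canonical additive character ($p$ the characteristic, $\zeta_p=e^{2\pi i/p}$). Code: fix an ordering $x_1,\dots,x_{q^m-1}$ of $\mathbb{F}_{q^m}^*$, let $f_D$ be the characteristic function of $D$ with values in $\{0,1\}\subseteq\mathbb{F}_q$, and for $(u,v)\in\mathbb{F}_q\times\mathbb{F}_{q^m}$ put $c(u,v)=(uf_D(x_i)+\mathrm{Tr}(vx_i))_{1\le i\le q^m-1}$; $\mathcal C(M_D)=\{c(u,v)\}$. A linear code is minimal if whenever codewords $c,c'$ satisfy $\mathrm{supp}(c')\subseteq\mathrm{supp}(c)$ (supports = sets of nonzero coordinates) then $c'=\lambda c$ for some $\lambda\in\mathbb{F}_q$. *)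

theory Defs
  imports "HOL-Analysis.Analysis" "HOL-Number_Theory.Prime_Powers"
begin

definition is_subfield :: "'a::field set \<Rightarrow> bool" where
  "is_subfield K \<longleftrightarrow> 0 \<in> K \<and> 1 \<in> K \<and>
     (\<forall>x\<in>K. \<forall>y\<in>K. x + y \<in> K \<and> x * y \<in> K) \<and>
     (\<forall>x\<in>K. - x \<in> K \<and> inverse x \<in> K)"

text \<open>The relative trace from the field of order \<open>q ^ m\<close> down to its subfield of order \<open>q\<close>,
  as the sum of the Galois conjugates of \<open>x\<close> (powers of the \<open>q\<close>-Frobenius map).\<close>

definition rel_trace :: "nat \<Rightarrow> nat \<Rightarrow> 'a::field \<Rightarrow> 'a" where
  "rel_trace q m x = (\<Sum>i<m. x ^ (q ^ i))"

definition scalar_invariant :: "'a::field set \<Rightarrow> 'a set \<Rightarrow> bool" where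
  "scalar_invariant K D \<longleftrightarrow> (\<forall>a\<in>K - {0}. \<forall>d\<in>D. a * d \<in> D)"

text \<open>A graph is given by its adjacency relation; the vertex set is the whole finite type.\<close>

definition strongly_regular ::
    "('a::finite \<Rightarrow> 'a \<Rightarrow> bool) \<Rightarrow> nat \<Rightarrow> nat \<Rightarrow> nat \<Rightarrow> nat \<Rightarrow> bool" where
  "strongly_regular E v k l \<mu> \<longleftrightarrow>
     (\<forall>x. \<not> E x x) \<and> (\<forall>x y. E x y \<longrightarrow> E y x) \<and>
     (\<exists>x y. x \<noteq> y \<and> \<not> E x y) \<and> (\<exists>x y. E x y) \<and>
     CARD('a) = v \<and>
     (\<forall>x. card {y. E x y} = k) \<and>
     (\<forall>x y. E x y \<longrightarrow> card {z. E x z \<and> E y z} = l) \<and>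
     (\<forall>x y. x \<noteq> y \<and> \<not> E x y \<longrightarrow> card {z. E x z \<and> E y z} = \<mu>)"

definition cayley :: "'a::group_add set \<Rightarrow> 'a \<Rightarrow> 'a \<Rightarrow> bool" where
  "cayley D x y \<longleftrightarrow> x - y \<in> D"

definition partial_difference_set ::
    "'a::{group_add,finite} set \<Rightarrow> nat \<Rightarrow> nat \<Rightarrow> nat \<Rightarrow> nat \<Rightarrow> bool" where
  "partial_difference_set D v k l \<mu> \<longleftrightarrow>
     0 \<notin> D \<and> uminus ` D = D \<and> strongly_regular (cayley D) v k l \<mu>"

definition adjacency_matrix :: "('a::finite \<Rightarrow> 'a \<Rightarrow> bool) \<Rightarrow> real ^ 'a ^ 'a" where
  "adjacency_matrix E = (\<chi> x y. if E x y then 1 else 0)"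

text \<open>The constant \<open>1\<close> of type \<open>real ^ 'n\<close> is the all-one vector.\<close>

definition restricted_eigenvalue :: "real ^ 'n ^ 'n \<Rightarrow> real \<Rightarrow> bool" where
  "restricted_eigenvalue A \<theta> \<longleftrightarrow>
     (\<exists>w. w \<noteq> 0 \<and> A *v w = \<theta> *\<^sub>R w \<and> orthogonal w 1)"

text \<open>Codewords are lists over the big field. The list \<open>xs\<close> carries the chosen ordering of the
  nonzero field elements, and \<open>K\<close> is the subfield of order \<open>q\<close>, from which the codeword entries
  and the scalars are taken.\<close>

definition codeword ::
    "nat \<Rightarrow> nat \<Rightarrow> 'a::field list \<Rightarrow> 'a set \<Rightarrow> 'a \<Rightarrow> 'a \<Rightarrow> 'a list" where
  "codeword q m xs D u v = map (\<lambda>x. u * indicator D x + rel_trace q m (v * x)) xs"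

definition code ::
    "'a::field set \<Rightarrow> nat \<Rightarrow> nat \<Rightarrow> 'a list \<Rightarrow> 'a set \<Rightarrow> 'a list set" where
  "code K q m xs D = {codeword q m xs D u v | u v. u \<in> K}"

definition supp :: "'a::zero list \<Rightarrow> nat set" where
  "supp c = {i. i < length c \<and> c ! i \<noteq> 0}"

definition minimal_code :: "'a::field set \<Rightarrow> 'a list set \<Rightarrow> bool" where
  "minimal_code K C \<longleftrightarrow>
     (\<forall>c\<in>C. \<forall>c'\<in>C. supp c' \<subseteq> supp c \<longrightarrow> (\<exists>a\<in>K. c' = map ((*) a) c))"

end

theory Submission
  imports Defs
begin

text \<open>By scalar invariance of \<open>D\<close>, each hyperplane \<open>ker v = {x. Tr (v x) = 0}\<close> yields a real
  eigenvector of the Cayley graph, whose eigenvalue \<open>\<theta>\<close> satisfies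
  \<open>q |D \<inter> ker v| = k + (q - 1) \<theta>\<close>. So \<open>D\<close> has only two hyperplane intersection sizes.
  If the zeros of \<open>c(u, v)\<close> are zeros of \<open>c(u', v')\<close> and the two words are not proportional,
  then \<open>D\<close> is squeezed between unions and differences of two hyperplanes. Counting \<open>D\<close> along the
  pencil of hyperplanes spanned by these two then gives, according to whether \<open>u = 0\<close>,
  \<open>v = 0\<close> or neither vanishes, linear relations between \<open>k\<close>, \<open>\<theta>\<^sub>1\<close>, \<open>\<theta>\<^sub>2\<close> and \<open>q ^ (m - 1)\<close>
  that the hypotheses exclude.\<close>

section \<open>The relative trace of a finite field\<close>

text \<open>Multiplication by a nonzero \<open>x\<close> permutes \<open>K - {0}\<close>, so the
  product of its elements is unchanged by the factor \<open>x ^ card (K - {0})\<close>.\<close>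

lemma subfield_power_card:
  fixes K :: "'a::{field,finite} set"
  assumes "is_subfield K" "x \<in> K"
  shows "x ^ card K = x"
proof (cases "x = 0")
  case True
  have "card K > 0" using assms by (auto simp: card_gt_0_iff)
  with True show ?thesis by simp
next
  case False
  have K: "0 \<in> K" "\<And>y z. y \<in> K \<Longrightarrow> z \<in> K \<Longrightarrow> y * z \<in> K" "\<And>y. y \<in> K \<Longrightarrow> inverse y \<in> K"
    using assms(1) by (auto simp: is_subfield_def)
  have card: "card K = Suc (card (K - {0}))"
    using card.remove[of K 0] K(1) by simp
  have "(\<Prod>y\<in>K-{0}. x * y) = (\<Prod>y\<in>K-{0}. y)"
    by (rule prod.reindex_bij_witness[of _ "\<lambda>y. y * inverse x" "\<lambda>y. x * y"])
       (use False assms K in auto)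
  hence "x ^ card (K - {0}) * \<Prod>(K - {0}) = \<Prod>(K - {0})"
    by (simp add: prod.distrib)
  moreover have "\<Prod>(K - {0}) \<noteq> 0" by (simp add: prod_zero_iff)
  ultimately have "x ^ card (K - {0}) = 1" by simp
  thus ?thesis by (simp add: card)
qed

text \<open>Translation by 1 permutes the ring, so adding 1 to every element leaves the sum of all
  elements unchanged.\<close>

lemma of_nat_CARD_eq_0: "of_nat CARD('a) = (0 :: 'a::{ring_1,finite})"
proof -
  have "(\<Sum>x\<in>UNIV. x + 1) = (\<Sum>x\<in>UNIV. x :: 'a)"
    by (rule sum.reindex_bij_witness[of _ "\<lambda>x. x - 1" "\<lambda>x. x + 1"]) auto
  thus ?thesis by (simp add: sum.distrib)
qed

locale trace_extension =
  fixes K :: "'a::{field,finite} set" and q m :: nat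
  assumes primepow_q: "primepow q" and m_pos: "m > 0" and CARD_eq: "CARD('a) = q ^ m"
    and subfield: "is_subfield K" and card_K: "card K = q"
begin

abbreviation Tr :: "'a \<Rightarrow> 'a" where "Tr \<equiv> rel_trace q m"

text \<open>Indexing hyperplanes by \<open>v\<close> makes the pencil through \<open>ker v\<close>
  and \<open>ker w\<close> consist of \<open>ker w\<close> and the sets
  \<open>ker (v + a * w)\<close> with \<open>a \<in> K\<close>.\<close>

definition ker :: "'a \<Rightarrow> 'a set" where "ker v = {x. Tr (v * x) = 0}"

lemma K_closed:
  "0 \<in> K" "1 \<in> K" "\<And>x y. x \<in> K \<Longrightarrow> y \<in> K \<Longrightarrow> x + y \<in> K"
  "\<And>x y. x \<in> K \<Longrightarrow> y \<in> K \<Longrightarrow> x * y \<in> K" "\<And>x. x \<in> K \<Longrightarrow> - x \<in> K"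
  "\<And>x y. x \<in> K \<Longrightarrow> y \<in> K \<Longrightarrow> x / y \<in> K"
  using subfield by (auto simp: is_subfield_def divide_inverse)

lemma q_ge_2: "q \<ge> 2"
  using primepow_gt_Suc_0[OF primepow_q] by simp

section \<open>Frobenius powers and their fixed points\<close>

lemma prime_CHAR: "prime CHAR('a)"
  using prime_CHAR_semidom[where ?'a = 'a] finite_imp_CHAR_pos[where ?'a = 'a] by simp

text \<open>Since \<open>q ^ m\<close> vanishes in the field, the prime below \<open>q\<close> is
  the characteristic. This makes \<open>q\<close>-th powers additive.\<close>

lemma q_power_CHAR: "\<exists>n. q = CHAR('a) ^ n"
proof -
  obtain p n where pn: "prime p" "n > 0" "q = p ^ n"
    using primepow_q by (auto simp: primepow_def)
  have "of_nat q ^ m = (0::'a)"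
    using of_nat_CARD_eq_0[where ?'a = 'a] by (simp add: CARD_eq)
  hence "CHAR('a) dvd q" using m_pos by (simp add: of_nat_eq_0_iff_char_dvd)
  hence "CHAR('a) dvd p" using pn prime_CHAR prime_dvd_power by blast
  hence "CHAR('a) = p" using pn(1) prime_CHAR primes_dvd_imp_eq by blast
  with pn show ?thesis by blast
qed

lemma frobenius_add: "(x + y :: 'a) ^ (q ^ i) = x ^ (q ^ i) + y ^ (q ^ i)"
proof -
  obtain n where "q = CHAR('a) ^ n" using q_power_CHAR by blast
  hence "q ^ i = CHAR('a) ^ (n * i)" by (simp add: power_mult)
  thus ?thesis by (rule freshmans_dream'[OF prime_CHAR])
qed

lemma frobenius_sum: "(sum f A :: 'a) ^ q = (\<Sum>i\<in>A. f i ^ q)"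
proof -
  obtain n where "q = CHAR('a) ^ n" using q_power_CHAR by blast
  thus ?thesis by (rule freshmans_dream_sum'[OF prime_CHAR])
qed

lemma K_power_q: "a \<in> K \<Longrightarrow> a ^ (q ^ i) = a"
proof (induction i)
  case (Suc i)
  have "a ^ (q ^ Suc i) = (a ^ q) ^ (q ^ i)" by (simp add: power_mult)
  thus ?case using Suc subfield_power_card[OF subfield, of a] by (simp add: card_K)
qed simp

lemma power_CARD: "(x::'a) ^ (q ^ m) = x"
proof -
  have "is_subfield (UNIV :: 'a set)" by (simp add: is_subfield_def)
  from subfield_power_card[OF this, of x] show ?thesis by (simp add: CARD_eq)
qed

section \<open>Linearity and values of the trace\<close>

lemma Tr_add: "Tr (x + y) = Tr x + Tr y"
  by (simp add: rel_trace_def frobenius_add sum.distrib)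

lemma Tr_scale: "a \<in> K \<Longrightarrow> Tr (a * x) = a * Tr x"
  by (simp add: rel_trace_def power_mult_distrib K_power_q sum_distrib_left)

lemma Tr_0 [simp]: "Tr 0 = 0"
  using Tr_scale[OF K_closed(1), of 0] by simp

lemma Tr_minus: "Tr (- x) = - Tr x"
  using Tr_add[of x "- x"] by (simp add: eq_neg_iff_add_eq_0 add.commute)

lemma Tr_diff: "Tr (x - y) = Tr x - Tr y"
  using Tr_add[of x "- y"] Tr_minus[of y] by simp

text \<open>The polynomial X^q - X has at most \<open>q\<close> roots, and the \<open>q\<close>
  elements of \<open>K\<close> already are roots.\<close>

lemma fixed_points_frobenius: "x ^ q = x \<Longrightarrow> x \<in> K"
proof -
  assume x: "x ^ q = x"
  define p :: "'a poly" where "p = monom 1 q - monom 1 1"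
  have "coeff p q = 1" using q_ge_2 by (simp add: p_def)
  hence "p \<noteq> 0" by auto
  have "degree p \<le> q"
    unfolding p_def using q_ge_2 by (intro degree_diff_le) (auto simp: degree_monom_eq)
  hence "card {y. poly p y = 0} \<le> q"
    using card_poly_roots_bound[OF \<open>p \<noteq> 0\<close>] by linarith
  moreover have "K \<subseteq> {y. poly p y = 0}"
    using K_power_q[of _ 1] by (auto simp: p_def poly_monom)
  ultimately have "K = {y. poly p y = 0}"
    by (intro card_seteq) (auto simp: card_K)
  thus ?thesis using x by (auto simp: p_def poly_monom)
qed

text \<open>Raising to the power \<open>q\<close> shifts the conjugates cyclically: the last one
  becomes \<open>x ^ (q ^ m) = x\<close>.\<close>

lemma Tr_in_K [simp]: "Tr x \<in> K"
proof (rule fixed_points_frobenius)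
  obtain n where m: "m = Suc n" using m_pos by (cases m) auto
  have "Tr x ^ q = (\<Sum>i<m. x ^ (q ^ Suc i))"
    by (simp add: rel_trace_def frobenius_sum mult.commute flip: power_mult)
  also have "\<dots> = (\<Sum>i<n. x ^ (q ^ Suc i)) + x"
    using power_CARD[of x] by (simp add: m)
  also have "\<dots> = Tr x"
    unfolding rel_trace_def m sum.lessThan_Suc_shift by (simp add: add.commute)
  finally show "Tr x ^ q = Tr x" .
qed

text \<open>As a polynomial in \<open>x\<close> the trace has degree \<open>q ^ (m - 1)\<close>, hence fewer roots than the field
  has elements.\<close>

lemma Tr_nonzero: "\<exists>x. Tr x \<noteq> 0"
proof (rule ccontr)
  assume zero: "\<not> ?thesis"
  define p :: "'a poly" where "p = (\<Sum>i<m. monom 1 (q ^ i))"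
  have inj: "q ^ i = q ^ j \<longleftrightarrow> i = j" for i j using q_ge_2 by simp
  have "coeff p (q ^ (m - 1)) = (\<Sum>i<m. if i = m - 1 then 1 else 0)"
    by (simp add: p_def coeff_sum inj)
  also have "\<dots> = 1" using m_pos by (simp add: sum.delta)
  finally have "p \<noteq> 0" by auto
  have "degree p \<le> q ^ (m - 1)" unfolding p_def
    using q_ge_2 by (intro degree_sum_le) (auto simp: degree_monom_eq intro!: power_increasing)
  moreover have "{x. poly p x = 0} = UNIV"
    using zero by (auto simp: p_def poly_sum poly_monom rel_trace_def)
  ultimately have "q ^ m \<le> q ^ (m - 1)"
    using card_poly_roots_bound[OF \<open>p \<noteq> 0\<close>] by (simp add: CARD_eq)
  thus False using q_ge_2 m_pos by (simp add: power_le_imp_le_exp)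
qed

section \<open>The trace form and its hyperplanes\<close>

lemma Tr_nondegenerate:
  assumes "\<And>x. Tr (v * x) = 0" shows "v = 0"
proof (rule ccontr)
  assume "v \<noteq> 0"
  obtain y where "Tr y \<noteq> 0" using Tr_nonzero by blast
  with assms[of "y / v"] \<open>v \<noteq> 0\<close> show False by simp
qed

lemma Tr_mult_eq_1:
  assumes "v \<noteq> 0" shows "\<exists>x. Tr (v * x) = 1"
proof -
  obtain y where y: "Tr (v * y) \<noteq> 0" using assms Tr_nondegenerate by blast
  have "Tr (v * (y / Tr (v * y))) = 1"
    using Tr_scale[of "1 / Tr (v * y)" "v * y"] K_closed y by simp
  thus ?thesis by blast
qed

text \<open>If \<open>Tr (v * x) = 1\<close>, then \<open>y - Tr (v * y) * x\<close> is a projection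
  of \<open>y\<close> to \<open>ker v\<close>, hence lies in \<open>ker w\<close>. So
  \<open>Tr (w * y) = Tr (w * x) * Tr (v * y)\<close> for all \<open>y\<close>, and nondegeneracy
  gives the scalar \<open>Tr (w * x)\<close>.\<close>

lemma ker_subset_imp_multiple:
  assumes "v \<noteq> 0" "ker v \<subseteq> ker w"
  shows "\<exists>a\<in>K. w = a * v"
proof -
  obtain x where x: "Tr (v * x) = 1" using Tr_mult_eq_1[OF assms(1)] by blast
  have "Tr ((w - Tr (w * x) * v) * y) = 0" for y
  proof -
    have "Tr (v * (y - Tr (v * y) * x)) = Tr (v * y) - Tr (Tr (v * y) * (v * x))"
      by (simp add: algebra_simps Tr_diff)
    also have "\<dots> = 0" by (simp add: Tr_scale x)
    finally have "y - Tr (v * y) * x \<in> ker w" using assms(2) by (auto simp: ker_def)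
    moreover have "Tr (w * (y - Tr (v * y) * x)) = Tr (w * y) - Tr (Tr (v * y) * (w * x))"
      by (simp add: algebra_simps Tr_diff)
    moreover have "Tr ((w - Tr (w * x) * v) * y) = Tr (w * y) - Tr (Tr (w * x) * (v * y))"
      by (simp add: algebra_simps Tr_diff)
    moreover have "Tr (Tr (v * y) * (w * x)) = Tr (v * y) * Tr (w * x)"
      "Tr (Tr (w * x) * (v * y)) = Tr (w * x) * Tr (v * y)"
      by (simp_all add: Tr_scale)
    ultimately show ?thesis by (simp add: ker_def)
  qed
  hence "w - Tr (w * x) * v = 0" by (rule Tr_nondegenerate)
  thus ?thesis by auto
qed

section \<open>Pencil counts, fibres and hyperplane sizes\<close>

lemma ker_scale: "a \<in> K \<Longrightarrow> a \<noteq> 0 \<Longrightarrow> ker (a * v) = ker v"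
  by (auto simp: ker_def Tr_scale mult.assoc)

lemma zero_in_ker [simp]: "0 \<in> ker v"
  by (simp add: ker_def)

text \<open>\<open>Tr (v * x) + a * Tr (w * x)\<close> vanishes for exactly one \<open>a\<close> if
  \<open>Tr (w * x) \<noteq> 0\<close>, and is independent of \<open>a\<close> otherwise. So points
  of both \<open>ker v\<close> and \<open>ker w\<close> are counted q + 1 times, all others
  once.\<close>

lemma sum_indicator_ker_pencil:
  "(\<Sum>a\<in>K. indicator (ker (v + a * w)) x) + indicator (ker w) x
     = (1 + q * indicator (ker v \<inter> ker w) x :: nat)"
proof (cases "Tr (w * x) = 0")
  case True
  have "x \<in> ker (v + a * w) \<longleftrightarrow> x \<in> ker v" if "a \<in> K" for a
    using True that Tr_scale[OF that, of "w * x"]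
    by (simp add: ker_def distrib_right Tr_add mult.assoc)
  hence "(\<Sum>a\<in>K. indicator (ker (v + a * w)) x) = (\<Sum>a\<in>K. indicator (ker v) x :: nat)"
    by (intro sum.cong) (auto simp: indicator_def)
  thus ?thesis using True by (simp add: indicator_def ker_def card_K)
next
  case False
  define b where "b = - Tr (v * x) / Tr (w * x)"
  have b: "b \<in> K" by (simp add: b_def K_closed)
  have "x \<in> ker (v + a * w) \<longleftrightarrow> a = b" if "a \<in> K" for a
  proof -
    have "Tr ((v + a * w) * x) = Tr (v * x) + Tr (a * (w * x))"
      by (simp add: algebra_simps Tr_add)
    hence "Tr ((v + a * w) * x) = Tr (v * x) + a * Tr (w * x)"
      by (simp add: Tr_scale that)
    thus ?thesis using False by (auto simp: ker_def b_def field_simps add_eq_0_iff)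
  qed
  hence "(\<Sum>a\<in>K. indicator (ker (v + a * w)) x) = (\<Sum>a\<in>K. if a = b then 1 else 0 :: nat)"
    by (intro sum.cong) (auto simp: indicator_def)
  also have "\<dots> = 1" using b by (simp add: sum.delta)
  finally show ?thesis using False by (simp add: indicator_def ker_def)
qed

lemma card_ker_pencil:
  "(\<Sum>a\<in>K. card (S \<inter> ker (v + a * w))) + card (S \<inter> ker w)
     = card S + q * card (S \<inter> ker v \<inter> ker w)"
proof -
  have c: "card (S \<inter> T) = (\<Sum>x\<in>S. indicator T x)" for T :: "'a set"
    by (simp add: sum_indicator_eq_card)
  have "(\<Sum>a\<in>K. card (S \<inter> ker (v + a * w))) + card (S \<inter> ker w)
      = (\<Sum>x\<in>S. (\<Sum>a\<in>K. indicator (ker (v + a * w)) x) + indicator (ker w) x)"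
    unfolding c sum.distrib by (subst sum.swap) simp
  also have "\<dots> = card S + q * card (S \<inter> (ker v \<inter> ker w))"
    unfolding sum_indicator_ker_pencil c sum.distrib by (simp add: sum_distrib_left del: sum_indicator_eq_card)
  finally show ?thesis by (simp add: Int_assoc)
qed

text \<open>Scaling by \<open>t / s\<close> carries the fibre over \<open>s\<close> onto the fibre
  over \<open>t\<close>, so the q - 1 fibres over nonzero values, which partition
  \<open>S - ker v\<close>, have equal size.\<close>

lemma card_fiber_scalar_invariant:
  assumes S: "scalar_invariant K S" and t: "t \<in> K" "t \<noteq> 0"
  shows "(q - 1) * card {x\<in>S. Tr (v * x) = t} = card S - card (S \<inter> ker v)"
proof -
  have inv: "a * x \<in> S" if "a \<in> K" "a \<noteq> 0" "x \<in> S" for a x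
    using S that by (auto simp: scalar_invariant_def)
  have fib: "card {x\<in>S. Tr (v * x) = s} = card {x\<in>S. Tr (v * x) = t}" if s: "s \<in> K - {0}" for s
  proof (rule bij_betw_same_card, rule bij_betw_byWitness[where f = "\<lambda>x. (t / s) * x" and f' = "\<lambda>x. (s / t) * x"])
    show "\<forall>x\<in>{x\<in>S. Tr (v * x) = s}. (s / t) * ((t / s) * x) = x" using s t by simp
    show "\<forall>x\<in>{x\<in>S. Tr (v * x) = t}. (t / s) * ((s / t) * x) = x" using s t by simp
    have e: "(r / c) * x \<in> {x\<in>S. Tr (v * x) = r}"
      if "r \<in> K - {0}" "c \<in> K - {0}" "x \<in> {x\<in>S. Tr (v * x) = c}" for r c x
      using that inv[of "r / c" x] Tr_scale[of "r / c" "v * x"] K_closed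
      by (simp add: mult.left_commute)
    show "(\<lambda>x. (t / s) * x) ` {x\<in>S. Tr (v * x) = s} \<subseteq> {x\<in>S. Tr (v * x) = t}"
      using e s t by blast
    show "(\<lambda>x. (s / t) * x) ` {x\<in>S. Tr (v * x) = t} \<subseteq> {x\<in>S. Tr (v * x) = s}"
      using e s t by blast
  qed
  have "card S - card (S \<inter> ker v) = card (S - ker v)"
    by (simp add: card_Diff_subset_Int)
  also have "S - ker v = (\<Union>s\<in>K-{0}. {x\<in>S. Tr (v * x) = s})"
    by (auto simp: ker_def)
  also have "card \<dots> = (\<Sum>s\<in>K-{0}. card {x\<in>S. Tr (v * x) = s})"
    by (rule card_UN_disjoint) auto
  also have "\<dots> = (q - 1) * card {x\<in>S. Tr (v * x) = t}"
    using K_closed(1) by (simp add: fib card_K card_Diff_singleton)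
  finally show ?thesis by simp
qed

text \<open>Translation by \<open>y\<close> with \<open>Tr (v * y) = 1\<close> matches
  \<open>ker v\<close> with the fibre over 1, so all \<open>q\<close> fibres have the same
  size.\<close>

lemma card_ker:
  assumes "v \<noteq> 0" shows "card (ker v) = q ^ (m - 1)"
proof -
  obtain y where y: "Tr (v * y) = 1" using Tr_mult_eq_1[OF assms] by blast
  have "bij_betw (\<lambda>x. x + y) (ker v) {x. Tr (v * x) = 1}"
    by (rule bij_betw_byWitness[where f' = "\<lambda>x. x - y"])
       (auto simp: ker_def algebra_simps Tr_add Tr_diff y)
  hence "card (ker v) = card {x. Tr (v * x) = 1}" by (rule bij_betw_same_card)
  moreover have "(q - 1) * card {x. Tr (v * x) = 1} = q ^ m - card (ker v)"
    using card_fiber_scalar_invariant[of UNIV 1 v] K_closed(2)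
    by (simp add: scalar_invariant_def CARD_eq)
  moreover have "card (ker v) \<le> q ^ m"
    unfolding CARD_eq[symmetric] by (rule card_mono) auto
  ultimately have "(q - 1) * card (ker v) + card (ker v) = q ^ m" by simp
  hence "q * card (ker v) = q ^ m"
    using q_ge_2 by (simp add: diff_mult_distrib)
  also have "\<dots> = q * q ^ (m - 1)" using m_pos by (cases m) auto
  finally show ?thesis using q_ge_2 by simp
qed

text \<open>Pencil count for the whole field: by independence every member of the pencil has size
  \<open>q ^ (m - 1)\<close>. The factor \<open>q\<close> avoids the exponent m - 2.\<close>

lemma card_ker_Int_ker:
  assumes "w \<noteq> 0" "\<forall>a\<in>K. v \<noteq> a * w"
  shows "q * card (ker v \<inter> ker w) = q ^ (m - 1)"
proof -
  have "v + a * w \<noteq> 0" if "a \<in> K" for a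
    using assms(2) K_closed(5)[OF that] by (metis add_eq_0_iff2 mult_minus_left)
  hence "(\<Sum>a\<in>K. card (ker (v + a * w))) = q * q ^ (m - 1)"
    by (simp add: card_ker card_K)
  hence "q * q ^ (m - 1) + q ^ (m - 1) = q ^ m + q * card (ker v \<inter> ker w)"
    using card_ker_pencil[of UNIV v w] assms(1) by (simp add: card_ker CARD_eq)
  moreover have "q ^ m = q * q ^ (m - 1)" using m_pos by (cases m) auto
  ultimately show ?thesis by simp
qed

section \<open>Eigenvectors from hyperplanes\<close>

lemma q_power_m: "q ^ m = q * q ^ (m - 1)"
  using m_pos by (cases m) auto

text \<open>The eigenvector is \<open>q\<close> times the indicator of the hyperplane \<open>ker v\<close>, minus one: the sum of
  the nontrivial additive characters that are trivial on \<open>ker v\<close>.\<close>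

lemma restricted_eigenvalue_ker:
  assumes D: "scalar_invariant K D" and v: "v \<noteq> 0"
  shows "restricted_eigenvalue (adjacency_matrix (cayley D))
           ((real q * card (D \<inter> ker v) - card D) / (real q - 1))"
    (is "restricted_eigenvalue _ ?\<theta>")
proof -
  define w :: "(real, 'a) vec" where "w = (\<chi> x. real q * indicator (ker v) x - 1)"
  have q1: "real q - 1 > 0" using q_ge_2 by simp
  have "w $ 0 \<noteq> 0" using q1 by (simp add: w_def)
  hence "w \<noteq> 0" by auto
  moreover have "orthogonal w 1"
  proof -
    have "inner w 1 = (\<Sum>x\<in>UNIV. real q * indicator (ker v) x - 1)"
      by (simp add: inner_vec_def w_def)
    also have "\<dots> = real q * card (ker v) - CARD('a)"
      using sum_mult_indicator[of UNIV "\<lambda>_. 1 :: real" "\<lambda>_. ker v" "\<lambda>x. x"]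
      by (simp add: sum_subtractf flip: sum_distrib_left)
    also have "\<dots> = 0" using q_power_m by (simp add: card_ker[OF v] CARD_eq)
    finally show ?thesis by (simp add: orthogonal_def)
  qed
  moreover have "(adjacency_matrix (cayley D) *v w) $ x = (?\<theta> *\<^sub>R w) $ x" for x
  proof -
    have "(adjacency_matrix (cayley D) *v w) $ x = (\<Sum>y\<in>UNIV. indicator D (x - y) * w $ y)"
      unfolding matrix_vector_mult_def adjacency_matrix_def cayley_def vec_lambda_beta
      by (rule sum.cong) (auto simp: indicator_def)
    also have "\<dots> = (\<Sum>d\<in>UNIV. indicator D d * w $ (x - d))"
      by (rule sum.reindex_bij_witness[of _ "\<lambda>y. x - y" "\<lambda>y. x - y"]) auto
    also have "\<dots> = (\<Sum>d\<in>D. w $ (x - d))"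
      by (simp add: sum_indicator_mult)
    also have "\<dots> = real q * (\<Sum>d\<in>D. indicator (ker v) (x - d)) - card D"
      by (simp add: w_def sum_subtractf sum_distrib_left)
    also have "(\<Sum>d\<in>D. indicator (ker v) (x - d)) = (\<Sum>d\<in>D. indicator {d. Tr (v * d) = Tr (v * x)} d :: real)"
      by (intro sum.cong) (auto simp: ker_def indicator_def right_diff_distrib Tr_diff)
    also have "\<dots> = card {d\<in>D. Tr (v * d) = Tr (v * x)}"
      using sum_mult_indicator[of D "\<lambda>_. 1 :: real" "\<lambda>_. {d. Tr (v * d) = Tr (v * x)}" "\<lambda>x. x"]
      by (simp add: Int_def)
    \<comment> \<open>On \<open>ker v\<close> the fibre is \<open>D \<inter> ker v\<close>; off it,
      scalar invariance makes the fibre size independent of the nonzero trace value. Both cases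
      yield the same \<open>?\<theta>\<close>.\<close>
    also have "real q * \<dots> - card D = ?\<theta> * w $ x"
    proof (cases "Tr (v * x) = 0")
      case True
      hence "{d\<in>D. Tr (v * d) = Tr (v * x)} = D \<inter> ker v" "w $ x = real q - 1"
        by (auto simp: ker_def w_def)
      thus ?thesis using q1 by simp
    next
      case False
      let ?c = "card {d\<in>D. Tr (v * d) = Tr (v * x)}"
      have "w $ x = -1" using False by (simp add: w_def ker_def)
      have le: "card (D \<inter> ker v) \<le> card D" by (intro card_mono) auto
      have "real ((q - 1) * ?c) = real (card D - card (D \<inter> ker v))"
        using card_fiber_scalar_invariant[OF D, of "Tr (v * x)" v] False by simp
      hence "(real q - 1) * ?c = real (card D) - card (D \<inter> ker v)"
        using le q_ge_2 by (simp add: of_nat_diff)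
      hence "(real q - 1) * (real q * ?c - card D) = - (real q * card (D \<inter> ker v) - card D)"
        by algebra
      thus ?thesis using q1 \<open>w $ x = -1\<close> by (simp add: field_simps)
    qed
    finally show ?thesis by simp
  qed
  hence "adjacency_matrix (cayley D) *v w = ?\<theta> *\<^sub>R w" by (simp add: vec_eq_iff)
  ultimately show ?thesis unfolding restricted_eigenvalue_def by blast
qed

end

section \<open>Sets with two hyperplane intersection sizes\<close>

text \<open>The spectral data in counting form: \<open>card_D_ker\<close> is the hyperplane
  eigenvalue solved for the intersection size, and \<open>\<theta>\<^sub>0\<close> bounds both
  \<open>\<theta>\<^sub>1\<close> and \<open>- \<theta>\<^sub>2\<close>.\<close>

locale two_eigenvalue_set = trace_extension K q m
  for K :: "'a::{field,finite} set" and q m :: nat +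
  fixes D :: "'a set" and \<theta>\<^sub>0 \<theta>\<^sub>1 \<theta>\<^sub>2 :: real
  assumes D_nonzero: "0 \<notin> D" and D_invariant: "scalar_invariant K D"
    and card_D_ker: "v \<noteq> 0 \<Longrightarrow>
      \<exists>\<theta>\<in>{\<theta>\<^sub>1, \<theta>\<^sub>2}. real q * card (D \<inter> ker v) = card D + (real q - 1) * \<theta>"
    and \<theta>\<^sub>1_pos: "\<theta>\<^sub>1 > 0" and \<theta>\<^sub>2_neg: "\<theta>\<^sub>2 < 0"
    and \<theta>\<^sub>0: "\<theta>\<^sub>0 \<ge> \<theta>\<^sub>1" "\<theta>\<^sub>0 \<ge> - \<theta>\<^sub>2"
    and cond1: "real (card D) - \<theta>\<^sub>2 \<noteq> real q ^ m"
    and cond2: "real (card D) > \<theta>\<^sub>1" "real (card D) > - (real q - 1) * \<theta>\<^sub>2"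
    and cond3: "real (card D) < real q ^ m + real q * \<theta>\<^sub>2 - (real q - 1) * \<theta>\<^sub>1
       \<or> real (card D) > max (real q * \<theta>\<^sub>0 + \<theta>\<^sub>1) (real q * \<theta>\<^sub>0 - (real q - 1) * \<theta>\<^sub>2)
       \<or> real q ^ (m - 1) + \<theta>\<^sub>2 - \<theta>\<^sub>1 > \<theta>\<^sub>0"
begin

lemma q_ge_2_real: "real q \<ge> 2"
  using q_ge_2 by simp

lemma D_scale: "a \<in> K \<Longrightarrow> a \<noteq> 0 \<Longrightarrow> x \<in> D \<Longrightarrow> a * x \<in> D"
  using D_invariant by (auto simp: scalar_invariant_def)

lemma q_power_m_real: "real q ^ m = real q * real q ^ (m - 1)"
  using q_power_m by (metis of_nat_mult of_nat_power)

lemma card_D_less: "real (card D) < real q ^ m"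
proof -
  have "card D < CARD('a)" using D_nonzero by (intro psubset_card_mono) auto
  thus ?thesis unfolding CARD_eq by (metis of_nat_less_iff of_nat_power)
qed

text \<open>An empty intersection would mean k = -(q - 1) \<theta>, which is negative for
  \<open>\<theta>\<^sub>1\<close> and excluded by \<open>cond2\<close> for
  \<open>\<theta>\<^sub>2\<close>.\<close>

lemma D_meets_ker:
  assumes "v \<noteq> 0" shows "D \<inter> ker v \<noteq> {}"
proof
  assume "D \<inter> ker v = {}"
  then obtain \<theta> where "\<theta> \<in> {\<theta>\<^sub>1, \<theta>\<^sub>2}" "card D + (real q - 1) * \<theta> = 0"
    using card_D_ker[OF assms] by auto
  moreover have "(real q - 1) * \<theta>\<^sub>1 > 0" using q_ge_2_real \<theta>\<^sub>1_pos by simp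
  ultimately show False using cond2 by (auto simp: algebra_simps)
qed

text \<open>The case u = 0: a nonzero \<open>u'\<close> would make \<open>Tr (v' * x)\<close>
  constantly \<open>- u'\<close> on \<open>D \<inter> ker v\<close>.\<close>

lemma zeros_of_trace_word:
  assumes v: "v \<noteq> 0" and u': "u' \<in> K"
    and zeros: "\<And>x. x \<noteq> 0 \<Longrightarrow> Tr (v * x) = 0 \<Longrightarrow> u' * indicator D x + Tr (v' * x) = 0"
  shows "u' = 0"
proof (rule ccontr)
  assume "u' \<noteq> 0"
  have on_D: "Tr (v' * x) = - u'" if "x \<in> D \<inter> ker v" for x
    using that zeros[of x] D_nonzero by (auto simp: ker_def add_eq_0_iff)
  obtain d where d: "d \<in> D \<inter> ker v" using D_meets_ker[OF v] by blast
  txt \<open>\<open>D \<inter> ker v\<close> is closed under scaling, whereas \<open>Tr (v' * x)\<close> takes a single nonzero value on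
    it. This forces \<open>q = 2\<close>.\<close>
  have "a = 1" if a: "a \<in> K" "a \<noteq> 0" for a
  proof -
    have "a * d \<in> D \<inter> ker v"
      using d a D_scale Tr_scale[OF a(1), of "v * d"] by (auto simp: ker_def mult.left_commute)
    from on_D[OF this] have "a * Tr (v' * d) = - u'"
      using Tr_scale[OF a(1), of "v' * d"] by (simp add: mult.left_commute)
    with on_D[OF d] \<open>u' \<noteq> 0\<close> show "a = 1" by simp
  qed
  hence K01: "K = {0, 1}" using K_closed(1,2) by auto
  have q2: "q = 2" using card_K by (simp add: K01)
  have indep: "\<forall>a\<in>K. v' \<noteq> a * v"
  proof (intro ballI notI)
    fix a assume "a \<in> K" "v' = a * v"
    hence "Tr (v' * d) = 0" using d Tr_scale[of a "v * d"] by (simp add: ker_def mult.assoc)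
    with on_D[OF d] \<open>u' \<noteq> 0\<close> show False by simp
  qed
  have nz: "v' \<noteq> 0" "v' + v \<noteq> 0"
    using indep K_closed(1) K_closed(5)[OF K_closed(2)]
    by (force simp: eq_neg_iff_add_eq_0[symmetric])+
  \<comment> \<open>A nonzero point of \<open>ker v\<close> outside \<open>D\<close> is a zero of
    \<open>Tr (v' * x)\<close>, while points of \<open>D \<inter> ker v\<close> have trace
    \<open>- u'\<close>.\<close>
  have "D \<inter> ker v = ker v - ker v'"
  proof (intro equalityI subsetI)
    show "x \<in> ker v - ker v'" if "x \<in> D \<inter> ker v" for x
      using on_D[OF that] that \<open>u' \<noteq> 0\<close> by (simp add: ker_def)
    show "x \<in> D \<inter> ker v" if "x \<in> ker v - ker v'" for x
      using zeros[of x] that by (cases "x = 0"; cases "x \<in> D") (auto simp: ker_def)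
  qed
  hence "card (D \<inter> ker v) = card (ker v) - card (ker v' \<inter> ker v)"
    by (simp add: card_Diff_subset_Int Int_commute)
  moreover have "2 * card (ker v' \<inter> ker v) = 2 ^ (m - 1)"
    using card_ker_Int_ker[OF v indep] by (simp add: q2)
  moreover have "card (ker v) = 2 ^ (m - 1)" using card_ker[OF v] by (simp only: q2)
  ultimately have "2 * card (D \<inter> ker v) = 2 ^ (m - 1)" by linarith
  hence N: "2 * real (card (D \<inter> ker v)) = 2 ^ (m - 1)"
    by (metis of_nat_mult of_nat_numeral of_nat_power)
  \<comment> \<open>No point of \<open>D\<close> is common to the pencil, so its three hyperplanes
    partition \<open>D\<close>.\<close>
  have "D \<inter> ker v' \<inter> ker v = {}" using on_D \<open>u' \<noteq> 0\<close> by (auto simp: ker_def)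
  hence "card (D \<inter> ker v') + card (D \<inter> ker (v' + v)) + card (D \<inter> ker v) = card D"
    using card_ker_pencil[of D v' v] by (simp add: K01)
  hence pencil: "real (card (D \<inter> ker v')) + card (D \<inter> ker (v' + v)) + card (D \<inter> ker v) = card D"
    by (metis of_nat_add)
  obtain \<alpha> \<beta> \<gamma> :: real where "\<alpha> \<in> {\<theta>\<^sub>1, \<theta>\<^sub>2}" "\<beta> \<in> {\<theta>\<^sub>1, \<theta>\<^sub>2}" "\<gamma> \<in> {\<theta>\<^sub>1, \<theta>\<^sub>2}"
    "2 * real (card (D \<inter> ker v)) = card D + \<alpha>"
    "2 * real (card (D \<inter> ker v')) = card D + \<beta>"
    "2 * real (card (D \<inter> ker (v' + v))) = card D + \<gamma>"
    using card_D_ker[OF v] card_D_ker[OF nz(1)] card_D_ker[OF nz(2)] by (auto simp: q2)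
  \<comment> \<open>Together these say \<beta> + \<gamma> = -2^(m - 1). Each of the eight choices of
    eigenvalues contradicts a sign, \<open>cond2\<close> or all alternatives of
    \<open>cond3\<close>.\<close>
  moreover from this have "card D + \<alpha> = 2 ^ (m - 1)" "card D + \<alpha> + \<beta> + \<gamma> = 0"
    using N pencil by linarith+
  ultimately show False
    using cond2 cond3 \<theta>\<^sub>1_pos \<theta>\<^sub>2_neg \<theta>\<^sub>0 q_power_m_real by (auto simp: q2)
qed

text \<open>The case v = 0 of the covering word. If \<open>v \<noteq> 0\<close> here,
  \<open>D\<close> contains the complement of \<open>ker v\<close>, and counting gives k - \<theta>
  = q^m: \<open>cond1\<close> excludes \<open>\<theta>\<^sub>2\<close>, and k < q^m excludes
  \<open>\<theta>\<^sub>1\<close>.\<close>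

lemma zeros_of_indicator_word:
  assumes zeros: "\<And>x. x \<notin> D \<Longrightarrow> Tr (v * x) = 0"
  shows "v = 0"
proof (rule ccontr)
  assume v: "v \<noteq> 0"
  obtain \<theta> where \<theta>: "\<theta> \<in> {\<theta>\<^sub>1, \<theta>\<^sub>2}" "real q * card (D \<inter> ker v) = card D + (real q - 1) * \<theta>"
    using card_D_ker[OF v] by blast
  have "D - ker v = UNIV - ker v" using zeros by (auto simp: ker_def)
  hence "card D - card (D \<inter> ker v) = q ^ m - q ^ (m - 1)"
    using card_Diff_subset_Int[of D "ker v"] card_Diff_subset[of "ker v" UNIV]
    by (simp add: CARD_eq card_ker[OF v])
  moreover have "card (D \<inter> ker v) \<le> card D" by (intro card_mono) auto
  moreover have "q ^ (m - 1) \<le> q ^ m" using q_ge_2 by (simp add: power_increasing)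
  ultimately have "real (card D) - card (D \<inter> ker v) = real q ^ m - real q ^ (m - 1)"
    by (metis of_nat_diff of_nat_power)
  moreover have "(r - 1) * (k - \<theta>) = (r - 1) * P"
    if "k - N = P - Q" "r * N = k + (r - 1) * \<theta>" "P = r * Q" for r k N P Q :: real
    using that by algebra
  ultimately have "(real q - 1) * (card D - \<theta>) = (real q - 1) * real q ^ m"
    using \<theta>(2) q_power_m_real by blast
  hence "card D - \<theta> = real q ^ m" using q_ge_2_real by simp
  with \<theta>(1) cond1 card_D_less \<theta>\<^sub>1_pos show False by auto
qed

text \<open>Up to scalars the zeros of the mixed word form the symmetric difference of
  \<open>D\<close> and \<open>ker v\<close>, which must therefore lie in
  \<open>ker w\<close>.\<close>

lemma zeros_of_mixed_word:
  assumes u: "u \<in> K" "u \<noteq> 0" and v: "v \<noteq> 0"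
    and zeros: "\<And>x. u * indicator D x + Tr (v * x) = 0 \<Longrightarrow> Tr (w * x) = 0"
  shows "w = 0"
proof (rule ccontr)
  assume w: "w \<noteq> 0"
  have D1: "D - ker v \<subseteq> ker w"
  proof
    fix d assume d: "d \<in> D - ker v"
    \<comment> \<open>This scalar moves \<open>d\<close> within \<open>D\<close> to a zero of the
      mixed word.\<close>
    define a where "a = - u / Tr (v * d)"
    have a: "a \<in> K" "a \<noteq> 0" using d u K_closed by (auto simp: a_def ker_def)
    have "Tr (v * (a * d)) = - u"
      using Tr_scale[OF a(1), of "v * d"] d by (simp add: a_def ker_def mult.left_commute)
    hence "Tr (w * (a * d)) = 0" using zeros[of "a * d"] D_scale[OF a] d by simp
    thus "d \<in> ker w" using Tr_scale[OF a(1), of "w * d"] a(2) by (simp add: ker_def mult.left_commute)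
  qed
  have D2: "ker v - D \<subseteq> ker w" using zeros by (auto simp: ker_def)
  obtain \<alpha> where \<alpha>: "\<alpha> \<in> {\<theta>\<^sub>1, \<theta>\<^sub>2}" "real q * card (D \<inter> ker v) = card D + (real q - 1) * \<alpha>"
    using card_D_ker[OF v] by blast
  show False
  proof (cases "\<exists>a\<in>K. v = a * w")
    case True
    hence "ker v = ker w" using v ker_scale by auto
    hence "D \<inter> ker v = D" using D1 by auto
    hence "(real q - 1) * card D = (real q - 1) * \<alpha>" using \<alpha>(2) by (simp add: algebra_simps)
    hence "card D = \<alpha>" using q_ge_2_real by simp
    thus False using \<alpha>(1) cond2 \<theta>\<^sub>2_neg by auto
  next
    case False
    hence indep: "\<forall>a\<in>K. v \<noteq> a * w" by blast
    have nz: "v + w \<noteq> 0"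
      using indep K_closed(5)[OF K_closed(2)] by (force simp: eq_neg_iff_add_eq_0[symmetric])
    obtain \<beta> where \<beta>: "\<beta> \<in> {\<theta>\<^sub>1, \<theta>\<^sub>2}"
      "real q * card (D \<inter> ker (v + w)) = card D + (real q - 1) * \<beta>"
      using card_D_ker[OF nz] by blast
    obtain \<gamma> where \<gamma>: "\<gamma> \<in> {\<theta>\<^sub>1, \<theta>\<^sub>2}" "real q * card (D \<inter> ker w) = card D + (real q - 1) * \<gamma>"
      using card_D_ker[OF w] by blast
    let ?N = "card (D \<inter> ker v \<inter> ker w)" and ?Q = "real q ^ (m - 1)"
    have diff: "real (card (A - B)) = real (card A) - card (A \<inter> B)" for A B :: "'a set"
      by (simp add: card_Diff_subset_Int of_nat_diff card_mono)
    \<comment> \<open>A point of \<open>D\<close> outside \<open>ker v\<close> lies in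
      \<open>ker w\<close>, hence not in \<open>ker (v + w)\<close>. So the triple intersection is
      itself governed by an eigenvalue, \<beta>.\<close>
    have "D \<inter> ker (v + w) = D \<inter> ker v \<inter> ker w"
      using D1 by (auto simp: ker_def distrib_right Tr_add)
    with \<beta>(2) have N0: "real q * ?N = card D + (real q - 1) * \<beta>" by simp
    have "D \<inter> ker v - ker w = ker v - ker w" using D2 by auto
    hence "real (card (D \<inter> ker v)) - ?N = ?Q - card (ker v \<inter> ker w)"
      by (metis diff card_ker[OF v] of_nat_power)
    moreover have "real q * card (ker v \<inter> ker w) = ?Q"
      using card_ker_Int_ker[OF w indep] by (metis of_nat_mult of_nat_power)
    moreover have "(r - 1) * (\<alpha> - \<beta>) = (r - 1) * Q"
      if "N - N0 = Q - i" "r * i = Q" "r * N = k + (r - 1) * \<alpha>" "r * N0 = k + (r - 1) * \<beta>"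
      for r N N0 Q i k :: real
      using that by algebra
    ultimately have "(real q - 1) * (\<alpha> - \<beta>) = (real q - 1) * ?Q"
      using \<alpha>(2) N0 by metis
    hence Q: "\<alpha> - \<beta> = ?Q" using q_ge_2_real by simp
    have "D - ker v = D \<inter> ker w - ker v" using D1 by auto
    hence "real (card D) - card (D \<inter> ker v) = real (card (D \<inter> ker w)) - card (D \<inter> ker w \<inter> ker v)"
      by (metis diff)
    hence "real (card D) - card (D \<inter> ker v) = real (card (D \<inter> ker w)) - ?N"
      by (simp add: Int_ac)
    hence "(real q - 1) * (card D) = (real q - 1) * (\<alpha> + \<gamma> - \<beta>)"
      using \<alpha>(2) \<gamma>(2) N0 by algebra
    hence k: "card D = \<alpha> + \<gamma> - \<beta>" using q_ge_2_real by simp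
    have "\<alpha> - \<beta> > 0" unfolding Q using q_ge_2 by simp
    with \<alpha>(1) \<beta>(1) \<theta>\<^sub>1_pos \<theta>\<^sub>2_neg have "\<alpha> = \<theta>\<^sub>1" "\<beta> = \<theta>\<^sub>2" by auto
    \<comment> \<open>\<open>\<gamma> = \<theta>\<^sub>2\<close> would give
      \<open>card D = \<theta>\<^sub>1\<close>, against \<open>cond2\<close>.\<close>
    with k cond2(1) \<gamma>(1) have k: "real (card D) = 2 * \<theta>\<^sub>1 - \<theta>\<^sub>2" by auto
    have Q: "?Q = \<theta>\<^sub>1 - \<theta>\<^sub>2" using Q \<open>\<alpha> = \<theta>\<^sub>1\<close> \<open>\<beta> = \<theta>\<^sub>2\<close> by simp
    have p: "real q * \<theta>\<^sub>0 \<ge> real q * \<theta>\<^sub>1" "real q * \<theta>\<^sub>0 \<ge> real q * - \<theta>\<^sub>2"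
      "real q * \<theta>\<^sub>1 \<ge> 2 * \<theta>\<^sub>1" "real q * - \<theta>\<^sub>2 \<ge> 2 * - \<theta>\<^sub>2"
      using \<theta>\<^sub>0 q_ge_2_real \<theta>\<^sub>1_pos \<theta>\<^sub>2_neg by (intro mult_left_mono mult_right_mono; simp)+
    have "real q ^ m = real q * \<theta>\<^sub>1 - real q * \<theta>\<^sub>2"
      unfolding q_power_m_real Q by (rule right_diff_distrib)
    \<comment> \<open>The alternatives of \<open>cond3\<close> become k <
      \<open>\<theta>\<^sub>1\<close>; a lower bound for k that is at least
      \<open>2 * \<theta>\<^sub>1 - \<theta>\<^sub>2\<close>, which is k; and 0 >
      \<open>\<theta>\<^sub>0\<close>.\<close>
    with cond3 k Q p \<theta>\<^sub>0 \<theta>\<^sub>1_pos \<theta>\<^sub>2_neg show False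
      unfolding left_diff_distrib mult_1 max_less_iff_conj by (elim disjE conjE) linarith+
  qed
qed

text \<open>Minimality in terms of functions on nonzero points. For u = 0 it reduces to an inclusion
  of hyperplanes; otherwise subtracting a multiple of the first word leaves a pure trace word, which
  is shown to be zero.\<close>

lemma codeword_multiple:
  assumes u: "u \<in> K" and u': "u' \<in> K"
    and zeros: "\<And>x. x \<noteq> 0 \<Longrightarrow> u * indicator D x + Tr (v * x) = 0
      \<Longrightarrow> u' * indicator D x + Tr (v' * x) = 0"
  shows "\<exists>a\<in>K. \<forall>x. x \<noteq> 0 \<longrightarrow>
    u' * indicator D x + Tr (v' * x) = a * (u * indicator D x + Tr (v * x))"
proof (cases "u = 0")
  case True
  show ?thesis
  proof (cases "v = 0")
    case True
    with \<open>u = 0\<close> zeros K_closed(1) show ?thesis by auto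
  next
    case False
    have "u' = 0" using zeros_of_trace_word[OF False u'] zeros True by auto
    have "ker v \<subseteq> ker v'"
    proof
      fix x assume "x \<in> ker v"
      thus "x \<in> ker v'" using zeros[of x] \<open>u = 0\<close> \<open>u' = 0\<close> by (cases "x = 0") (auto simp: ker_def)
    qed
    then obtain a where a: "a \<in> K" "v' = a * v" using ker_subset_imp_multiple[OF False] by blast
    thus ?thesis using \<open>u = 0\<close> \<open>u' = 0\<close> by (auto intro!: bexI[of _ a] simp: mult.assoc Tr_scale)
  qed
next
  case False
  \<comment> \<open>The only scalar that cancels the indicator part.\<close>
  define a where "a = u' / u"
  define w where "w = v' - a * v"
  have a: "a \<in> K" using u u' K_closed by (simp add: a_def)
  have Tr_w: "Tr (w * x) = Tr (v' * x) - a * Tr (v * x)" for x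
    using Tr_scale[OF a, of "v * x"] by (simp add: w_def left_diff_distrib Tr_diff mult.assoc)
  have word: "u' * indicator D x + Tr (v' * x) = a * (u * indicator D x + Tr (v * x)) + Tr (w * x)" for x
    using False by (simp add: Tr_w a_def field_simps)
  have zeros_w: "Tr (w * x) = 0" if "u * indicator D x + Tr (v * x) = 0" for x
    using zeros[of x] that word[of x] by (cases "x = 0") auto
  have "w = 0"
  proof (cases "v = 0")
    case True
    have "Tr (w * x) = 0" if "x \<notin> D" for x
      by (rule zeros_w) (simp add: True that)
    thus ?thesis by (rule zeros_of_indicator_word)
  next
    case v: False
    show ?thesis using zeros_w by (rule zeros_of_mixed_word[OF u False v])
  qed
  thus ?thesis using a word by auto
qed

end

section \<open>Minimality of the code\<close>

theorem theorem3:
  fixes K D :: "'a::{field,finite} set"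
    and xs :: "'a list"
    and q m k l \<mu> :: nat
    and \<theta>\<^sub>0 \<theta>\<^sub>1 \<theta>\<^sub>2 :: real
  assumes "primepow q" and "m > 0"
    and "CARD('a) = q ^ m"
    and "is_subfield K" and "card K = q"
    and "distinct xs" and "set xs = UNIV - {0}"
    and "D \<subseteq> UNIV - {0}"
    and "scalar_invariant K D"
    and "partial_difference_set D (q ^ m) k l \<mu>"
    and "{\<theta>. restricted_eigenvalue (adjacency_matrix (cayley D)) \<theta>} = {\<theta>\<^sub>1, \<theta>\<^sub>2}"
    and "\<theta>\<^sub>1 > 0" and "0 > \<theta>\<^sub>2"
    and "\<theta>\<^sub>0 = max \<bar>\<theta>\<^sub>1\<bar> \<bar>\<theta>\<^sub>2\<bar>"
    and "real k - \<theta>\<^sub>2 \<noteq> real q ^ m"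
    and "real k > \<theta>\<^sub>1" and "real k > - (real q - 1) * \<theta>\<^sub>2"
    and "real k < real q ^ m + real q * \<theta>\<^sub>2 - (real q - 1) * \<theta>\<^sub>1
       \<or> real k > max (real q * \<theta>\<^sub>0 + \<theta>\<^sub>1) (real q * \<theta>\<^sub>0 - (real q - 1) * \<theta>\<^sub>2)
       \<or> real q ^ (m - 1) + \<theta>\<^sub>2 - \<theta>\<^sub>1 > \<theta>\<^sub>0"
  shows "minimal_code K (code K q m xs D)"
proof -
  interpret trace_extension K q m
    by unfold_locales (use assms in auto)
  \<comment> \<open>The neighbourhood of 0 is -D = D, so the valency is
    \<open>card D\<close>.\<close>
  have "card {y. cayley D 0 y} = k" and "uminus ` D = D"
    using assms(10) by (auto simp: partial_difference_set_def strongly_regular_def)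
  moreover have "{y. cayley D 0 y} = uminus ` D"
    by (force simp: cayley_def)
  ultimately have k: "card D = k" by simp
  have eigen: "\<exists>\<theta>\<in>{\<theta>\<^sub>1, \<theta>\<^sub>2}. real q * card (D \<inter> ker v) = card D + (real q - 1) * \<theta>"
    if "v \<noteq> 0" for v
  proof
    let ?\<theta> = "(real q * card (D \<inter> ker v) - card D) / (real q - 1)"
    show "?\<theta> \<in> {\<theta>\<^sub>1, \<theta>\<^sub>2}"
      using restricted_eigenvalue_ker[OF assms(9) that] assms(11) by blast
    show "real q * card (D \<inter> ker v) = card D + (real q - 1) * ?\<theta>"
      using q_ge_2 by simp
  qed
  interpret two_eigenvalue_set K q m D \<theta>\<^sub>0 \<theta>\<^sub>1 \<theta>\<^sub>2
    by unfold_locales (use assms eigen k in auto)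
  show ?thesis
    unfolding minimal_code_def
  proof (intro ballI impI)
    fix c c' assume "c \<in> code K q m xs D" "c' \<in> code K q m xs D" and sub: "supp c' \<subseteq> supp c"
    then obtain u v u' v' where c: "c = codeword q m xs D u v" "u \<in> K"
      and c': "c' = codeword q m xs D u' v'" "u' \<in> K"
      by (auto simp: code_def)
    \<comment> \<open>Inclusion of supports is reverse inclusion of zeros; \<open>xs\<close> has a
      coordinate for every nonzero point.\<close>
    have zeros: "u' * indicator D x + Tr (v' * x) = 0"
      if "x \<noteq> 0" "u * indicator D x + Tr (v * x) = 0" for x
    proof -
      have "x \<in> set xs" using that(1) assms(7) by simp
      then obtain i where "i < length xs" "xs ! i = x" by (auto simp: in_set_conv_nth)
      moreover from this have "i \<notin> supp c" using that(2) by (simp add: supp_def c(1) codeword_def)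
      hence "i \<notin> supp c'" using sub by blast
      ultimately show ?thesis by (simp add: supp_def c'(1) codeword_def)
    qed
    have "\<exists>a\<in>K. \<forall>x. x \<noteq> 0 \<longrightarrow>
        u' * indicator D x + Tr (v' * x) = a * (u * indicator D x + Tr (v * x))"
      by (rule codeword_multiple[OF c(2) c'(2)]) (rule zeros)
    then obtain a where "a \<in> K" "\<forall>x. x \<noteq> 0 \<longrightarrow>
        u' * indicator D x + Tr (v' * x) = a * (u * indicator D x + Tr (v * x))"
      by (elim bexE)
    hence "c' = map ((*) a) c" using assms(7) by (simp add: c(1) c'(1) codeword_def)
    with \<open>a \<in> K\<close> show "\<exists>a\<in>K. c' = map ((*) a) c" by blast
  qed
qed

end
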